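(* Let $S$ be a densely defined, closed, symmetric operator in a Hilbert space $\mathcal H$ and let $\{\mathcal G,\Gamma_0,\Gamma_1\}$ be a quasi boundary triple for $T\subset S^*$ with corresponding $\gamma$-field $\gamma$ and Weyl function $M$; let $A_0=T\upharpoonright\ker\Gamma_0$ and $A_1=T\upharpoonright\ker\Gamma_1$. Let $B$ be a linear operator in $\mathcal G$ and assume that there exists $\lambda_0\in\rho(A_0)\cap\mathbb R$ such that the following conditions are satisfied: (i) $B$ is symmetric; (ii) $1\in\rho\bigl(B\overline{M(\lambda_0)}\bigr)$; (iii) $B\bigl(\operatorname{ran}\overline{M(\lambda_0)}\cap\operatorname{dom}B\bigr)\subset\operatorname{ran}\Gamma_0$; (iv) $\operatorname{ran}\Gamma_1\subset\operatorname{dom}B$; (v) $B(\operatorname{ran}\Gamma_1)\subset\operatorname{ran}\Gamma_0$, or $\lambda_0\in\rho(A_1)$. Then the operator $$A_{[B]}f=Tf,\qquad \operatorname{dom}A_{[B]}=\bigl\{f\in\operatorname{dom}T:\Gamma_0 f=B\Gamma_1 f\bigr\},$$ is a self-adjoint extension of $S$ such that $\lambda_0\in\rho(A_{[B]})$, and $$(A_{[B]}-\lambda)^{-1}=(A_0-\lambda)^{-1}+\gamma(\lambda)\bigl(I-BM(\lambda)\bigr)^{-1}B\gamma(\overline\lambda)^*$$ holds for all $\lambda\in\rho(A_{[B]})\cap\rho(A_0)$.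
   Context: Let $S$ be a densely defined, closed, symmetric operator in $\mathcal H$, and let $T\subset S^*$ be a linear operator with $\overline T=S^*$. A triple $\{\mathcal G,\Gamma_0,\Gamma_1\}$ is a quasi boundary triple for $T\subset S^*$ if $\mathcal G$ is a Hilbert space and $\Gamma_0,\Gamma_1:\operatorname{dom}T\to\mathcal G$ are linear maps such that: (1) $(Tf,g)-(f,Tg)=(\Gamma_1f,\Gamma_0g)-(\Gamma_0f,\Gamma_1g)$ for all $f,g\in\operatorname{dom}T$; (2) $(\Gamma_0,\Gamma_1)^\top:\operatorname{dom}T\to\mathcal G\times\mathcal G$ has dense range; (3) $A_0:=T\upharpoonright\ker\Gamma_0$ is self-adjoint in $\mathcal H$. Put $A_1:=T\upharpoonright\ker\Gamma_1$ (not necessarily self-adjoint). For $\lambda\in\rho(A_0)$ one has $\operatorname{dom}T=\ker\Gamma_0\,\dot+\,\ker(T-\lambda)$, so $\Gamma_0\upharpoonright\ker(T-\lambda)$ is injective with range $\operatorname{ran}\Gamma_0$. The $\gamma$-field is $\gamma(\lambda):=(\Gamma_0\upharpoonright\ker(T-\lambda))^{-1}$ (mapping $\operatorname{ran}\Gamma_0\subset\mathcal G$ onto $\ker(T-\lambda)$), and the Weyl function is $M(\lambda):=\Gamma_1\gamma(\lambda)$, an operator in $\mathcal G$ with domain $\operatorname{ran}\Gamma_0$, $\lambda\in\rho(A_0)$. One has $M(\lambda)\subset M(\overline\lambda)^*$, so $M(\lambda)$ is closable; $\overline{M(\lambda)}$ denotes its closure. The adjoint $\gamma(\lambda)^*$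 is bounded and everywhere defined from $\mathcal H$ to $\mathcal G$. *)

theory Defs
  imports "HOL-Analysis.Analysis"
begin

text \<open>
  Complex Hilbert spaces. As in spectral theory, the inner product is linear in its first argument
  and conjugate-linear in the second one.
\<close>

class complex_hilbert = banach +
  fixes scaleC :: "complex \<Rightarrow> 'a \<Rightarrow> 'a" (infixr "*\<^sub>C" 75)
    and cinner :: "'a \<Rightarrow> 'a \<Rightarrow> complex"
  assumes scaleC_add_right: "a *\<^sub>C (x + y) = a *\<^sub>C x + a *\<^sub>C y"
    and scaleC_add_left: "(a + b) *\<^sub>C x = a *\<^sub>C x + b *\<^sub>C x"
    and scaleC_scaleC: "a *\<^sub>C (b *\<^sub>C x) = (a * b) *\<^sub>C x"
    and scaleC_one: "1 *\<^sub>C x = x"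
    and scaleR_scaleC: "r *\<^sub>R x = complex_of_real r *\<^sub>C x"
    and cinner_commute: "cinner x y = cnj (cinner y x)"
    and cinner_add_left: "cinner (x + y) z = cinner x z + cinner y z"
    and cinner_scaleC_left: "cinner (a *\<^sub>C x) y = a * cinner x y"
    and cinner_ge_zero: "0 \<le> Re (cinner x x)"
    and cinner_eq_zero_iff: "cinner x x = 0 \<longleftrightarrow> x = 0"
    and norm_eq_sqrt_cinner: "norm x = sqrt (Re (cinner x x))"

instantiation complex :: complex_hilbert
begin

definition scaleC_complex :: "complex \<Rightarrow> complex \<Rightarrow> complex"
  where "scaleC_complex a x = a * x"

definition cinner_complex :: "complex \<Rightarrow> complex \<Rightarrow> complex"
  where "cinner_complex x y = x * cnj y"

instance
proof
  fix x :: complex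
  show "norm x = sqrt (Re (cinner x x))"
    by (simp add: cinner_complex_def cmod_def power2_eq_square)
qed (auto simp: scaleC_complex_def cinner_complex_def algebra_simps scaleR_conv_of_real)

end

text \<open>
  An operator with domain in one space and values in another one is identified with its graph, a set
  of pairs. Hence \<open>A \<subseteq> B\<close> says that \<open>B\<close> extends \<open>A\<close>; \<open>Domain A\<close> and \<open>Range A\<close> are its domain
  and range; \<open>A `` X\<close> is the image of \<open>X \<inter> Domain A\<close>; \<open>closure A\<close> is the graph of its closure;
  \<open>closed A\<close> says that \<open>A\<close> is a closed operator; \<open>Id\<close> is the identity; and \<open>converse A\<close> is the graph
  of the inverse, which is again single-valued exactly if \<open>A\<close> is injective.
\<close>

definition linear_op :: "('a::complex_hilbert \<times> 'b::complex_hilbert) set \<Rightarrow> bool"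
  where "linear_op A \<longleftrightarrow> single_valued A \<and> (0, 0) \<in> A \<and>
    (\<forall>x y x' y'. (x, y) \<in> A \<longrightarrow> (x', y') \<in> A \<longrightarrow> (x + x', y + y') \<in> A) \<and>
    (\<forall>a x y. (x, y) \<in> A \<longrightarrow> (a *\<^sub>C x, a *\<^sub>C y) \<in> A)"

abbreviation op_comp :: "('b \<times> 'c) set \<Rightarrow> ('a \<times> 'b) set \<Rightarrow> ('a \<times> 'c) set" (infixr "\<circ>\<^sub>o" 75)
  where "A \<circ>\<^sub>o B \<equiv> B O A"

text \<open>Sums and differences of operators live on the intersection of the two domains.\<close>

definition op_plus :: "('a \<times> 'b::ab_group_add) set \<Rightarrow> ('a \<times> 'b) set \<Rightarrow> ('a \<times> 'b) set"
    (infixl "+\<^sub>o" 65)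
  where "A +\<^sub>o B = {(x, y + z) | x y z. (x, y) \<in> A \<and> (x, z) \<in> B}"

definition op_minus :: "('a \<times> 'b::ab_group_add) set \<Rightarrow> ('a \<times> 'b) set \<Rightarrow> ('a \<times> 'b) set"
    (infixl "-\<^sub>o" 65)
  where "A -\<^sub>o B = {(x, y - z) | x y z. (x, y) \<in> A \<and> (x, z) \<in> B}"

definition scalar_op :: "complex \<Rightarrow> ('a::complex_hilbert \<times> 'a) set"
  where "scalar_op z = {(x, z *\<^sub>C x) | x. True}"

definition op_on :: "'a set \<Rightarrow> ('a \<Rightarrow> 'b) \<Rightarrow> ('a \<times> 'b) set"
  where "op_on D F = {(x, F x) | x. x \<in> D}"

definition op_ker :: "('a \<times> 'b::zero) set \<Rightarrow> 'a set"
  where "op_ker A = {x. (x, 0) \<in> A}"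

definition densely_defined :: "('a::topological_space \<times> 'b) set \<Rightarrow> bool"
  where "densely_defined A \<longleftrightarrow> closure (Domain A) = UNIV"

text \<open>The adjoint; it is single-valued exactly if \<open>A\<close> is densely defined.\<close>

definition adjoint_op ::
    "('a::complex_hilbert \<times> 'b::complex_hilbert) set \<Rightarrow> ('b \<times> 'a) set"
  where "adjoint_op A = {(y, x). \<forall>(u, v) \<in> A. cinner v y = cinner u x}"

definition symmetric_op :: "('a::complex_hilbert \<times> 'a) set \<Rightarrow> bool"
  where "symmetric_op A \<longleftrightarrow> (\<forall>(f, f') \<in> A. \<forall>(g, g') \<in> A. cinner f' g = cinner f g')"

definition self_adjoint_op :: "('a::complex_hilbert \<times> 'a) set \<Rightarrow> bool"
  where "self_adjoint_op A \<longleftrightarrow> linear_op A \<and> densely_defined A \<and> adjoint_op A = A"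

definition resolvent_op :: "('a::complex_hilbert \<times> 'a) set \<Rightarrow> complex \<Rightarrow> ('a \<times> 'a) set"
  where "resolvent_op A z = converse (A -\<^sub>o scalar_op z)"

text \<open>
  A point \<open>z\<close> belongs to the resolvent set if \<open>A - z\<close> has a bounded inverse that is defined on the
  whole space. The operator \<open>A\<close> is not required to be closed beforehand.
\<close>

definition resolvent_set :: "('a::complex_hilbert \<times> 'a) set \<Rightarrow> complex set"
  where "resolvent_set A = {z. single_valued (resolvent_op A z) \<and> Domain (resolvent_op A z) = UNIV \<and>
    (\<exists>C. \<forall>(g, f) \<in> resolvent_op A z. norm f \<le> C * norm g)}"

definition restrict_ker :: "('a \<times> 'a) set \<Rightarrow> ('a \<Rightarrow> 'b::zero) \<Rightarrow> ('a \<times> 'a) set"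
  where "restrict_ker T \<Gamma> = {(f, f'). (f, f') \<in> T \<and> \<Gamma> f = 0}"

text \<open>
  The boundary maps are functions on the whole type, of which only the values on \<open>Domain T\<close> matter.
\<close>

definition quasi_boundary_triple ::
    "('h::complex_hilbert \<times> 'h) set \<Rightarrow> ('h \<times> 'h) set \<Rightarrow> ('h \<Rightarrow> 'g::complex_hilbert) \<Rightarrow> ('h \<Rightarrow> 'g) \<Rightarrow> bool"
  where "quasi_boundary_triple S T \<Gamma>\<^sub>0 \<Gamma>\<^sub>1 \<longleftrightarrow>
    linear_op T \<and> T \<subseteq> adjoint_op S \<and> closure T = adjoint_op S \<and>
    linear_op (op_on (Domain T) \<Gamma>\<^sub>0) \<and> linear_op (op_on (Domain T) \<Gamma>\<^sub>1) \<and>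
    (\<forall>(f, f') \<in> T. \<forall>(g, g') \<in> T.
      cinner f' g - cinner f g' = cinner (\<Gamma>\<^sub>1 f) (\<Gamma>\<^sub>0 g) - cinner (\<Gamma>\<^sub>0 f) (\<Gamma>\<^sub>1 g)) \<and>
    closure ((\<lambda>f. (\<Gamma>\<^sub>0 f, \<Gamma>\<^sub>1 f)) ` Domain T) = UNIV \<and>
    self_adjoint_op (restrict_ker T \<Gamma>\<^sub>0)"

definition gamma_field ::
    "('h::complex_hilbert \<times> 'h) set \<Rightarrow> ('h \<Rightarrow> 'g::complex_hilbert) \<Rightarrow> complex \<Rightarrow> ('g \<times> 'h) set"
  where "gamma_field T \<Gamma>\<^sub>0 z = converse (op_on (op_ker (T -\<^sub>o scalar_op z)) \<Gamma>\<^sub>0)"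

definition weyl_function ::
    "('h::complex_hilbert \<times> 'h) set \<Rightarrow> ('h \<Rightarrow> 'g::complex_hilbert) \<Rightarrow> ('h \<Rightarrow> 'g) \<Rightarrow> complex \<Rightarrow> ('g \<times> 'g) set"
  where "weyl_function T \<Gamma>\<^sub>0 \<Gamma>\<^sub>1 z = op_on (Domain T) \<Gamma>\<^sub>1 \<circ>\<^sub>o gamma_field T \<Gamma>\<^sub>0 z"

text \<open>
  \<open>(\<Gamma>\<^sub>1 f, \<Gamma>\<^sub>0 f) \<in> B\<close> says that \<open>\<Gamma>\<^sub>1 f\<close> lies in the domain of \<open>B\<close> and is mapped to \<open>\<Gamma>\<^sub>0 f\<close>.
\<close>

definition extension_op ::
    "('h \<times> 'h) set \<Rightarrow> ('h \<Rightarrow> 'g) \<Rightarrow> ('h \<Rightarrow> 'g) \<Rightarrow> ('g \<times> 'g) set \<Rightarrow> ('h \<times> 'h) set"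
  where "extension_op T \<Gamma>\<^sub>0 \<Gamma>\<^sub>1 B = {(f, f'). (f, f') \<in> T \<and> (\<Gamma>\<^sub>1 f, \<Gamma>\<^sub>0 f) \<in> B}"

end

theory Submission
  imports Defs
begin

text \<open>
  Green's identity turns symmetry of \<open>B\<close> into symmetry of the extension, written \<open>A\<^bsub>[B]\<^esub>\<close> below, and
  \<open>S \<subseteq> A\<^bsub>[B]\<^esub>\<close> because both boundary maps vanish on the domain of \<open>S\<close>. For a symmetric, densely
  defined \<open>A\<^bsub>[B]\<^esub>\<close>, surjectivity of \<open>A\<^bsub>[B]\<^esub> - z\<^sub>0\<close> at the real point \<open>z\<^sub>0\<close> already gives
  self-adjointness, and the inverse is then bounded by the Hellinger--Toeplitz theorem (\<open>symmetric_surj_imp_self_adjoint\<close>). So everything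
  rests on solving \<open>(A\<^bsub>[B]\<^esub> - z\<^sub>0) f = g\<close>.

  Write \<open>f = a + b\<close>, where \<open>a\<close> is the solution for \<open>A\<^sub>0\<close>, the restriction of \<open>T\<close> to \<open>ker \<Gamma>\<^sub>0\<close>, and
  \<open>b\<close> lies in \<open>ker (T - z\<^sub>0)\<close>. The boundary condition \<open>\<Gamma>\<^sub>0 f = B (\<Gamma>\<^sub>1 f)\<close> becomes the equation
  \<open>\<psi> - B (M \<psi>) = B (\<Gamma>\<^sub>1 a)\<close> for \<open>\<psi> = \<Gamma>\<^sub>0 b\<close>, with \<open>M\<close> the Weyl function at \<open>z\<^sub>0\<close>. The assumption
  on the resolvent set of \<open>B\<close> composed with the closure of \<open>M\<close> gives a solution for that closure. By
  the range conditions \<open>B\<close> sends both the range of the closure and \<open>ran \<Gamma>\<^sub>1\<close> into \<open>ran \<Gamma>\<^sub>0\<close>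
  (\<open>boundary_operator_range\<close>), so the solution \<open>\<psi>\<close> is itself in \<open>ran \<Gamma>\<^sub>0\<close>. There the closure agrees
  with \<open>M\<close>, since \<open>M\<close> is symmetric with dense domain (\<open>closure_weyl_function_value\<close>), and \<open>\<psi>\<close> solves
  the original equation (\<open>extension_surj\<close>).

  The same splitting at a point \<open>z\<close> of the resolvent set of \<open>A\<^sub>0\<close> is Krein's formula (\<open>Krein_formula\<close>),
  once \<open>\<Gamma>\<^sub>1 a\<close> is recognised as the adjoint of \<open>\<gamma> (cnj z)\<close> applied to \<open>g\<close>. For this \<open>\<gamma> (cnj z)\<close> has to be
  densely defined, so one needs that the resolvent set of the self-adjoint operator \<open>A\<^sub>0\<close> is closed
  under conjugation (\<open>self_adjoint_resolvent_set_cnj\<close>); this is where orthogonal complements of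
  closed subspaces enter.
\<close>

section \<open>Geometry of complex Hilbert spaces\<close>

lemma cinner_add_right: "cinner x (y + z) = cinner x y + cinner x z"
  for x y z :: "'a::complex_hilbert"
  by (metis cinner_add_left cinner_commute complex_cnj_add)

lemma cinner_scaleC_right: "cinner x (a *\<^sub>C y) = cnj a * cinner x y"
  for x y :: "'a::complex_hilbert"
  by (metis cinner_scaleC_left cinner_commute complex_cnj_mult)

lemma scaleC_minus_one: "(- 1) *\<^sub>C x = - x" for x :: "'a::complex_hilbert"
  using scaleR_scaleC[of "-1" x] by simp

lemma scaleC_zero_left [simp]: "0 *\<^sub>C x = 0" for x :: "'a::complex_hilbert"
  using scaleR_scaleC[of 0 x] by simp

lemma scaleC_zero_right [simp]: "a *\<^sub>C 0 = (0 :: 'a::complex_hilbert)"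
  using scaleC_add_right[of a 0 "0::'a"] by (metis add.right_neutral add_left_cancel)

lemma scaleC_minus_right: "a *\<^sub>C (- x) = - (a *\<^sub>C x)" for x :: "'a::complex_hilbert"
  using scaleC_add_right[of a x "- x"] by (simp add: eq_neg_iff_add_eq_0 add.commute)

lemma scaleC_diff_right: "a *\<^sub>C (x - y) = a *\<^sub>C x - a *\<^sub>C y" for x y :: "'a::complex_hilbert"
  using scaleC_add_right[of a x "- y"] by (simp add: scaleC_minus_right)

lemma cinner_minus_left: "cinner (- x) y = - cinner x y" for x y :: "'a::complex_hilbert"
  using cinner_scaleC_left[of "-1" x y] by (simp add: scaleC_minus_one)

lemma cinner_minus_right: "cinner x (- y) = - cinner x y" for x y :: "'a::complex_hilbert"
  using cinner_scaleC_right[of x "-1" y] by (simp add: scaleC_minus_one)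

lemma cinner_diff_left: "cinner (x - y) z = cinner x z - cinner y z"
  for x y z :: "'a::complex_hilbert"
  using cinner_add_left[of x "- y" z] by (simp add: cinner_minus_left)

lemma cinner_diff_right: "cinner x (y - z) = cinner x y - cinner x z"
  for x y z :: "'a::complex_hilbert"
  using cinner_add_right[of x y "- z"] by (simp add: cinner_minus_right)

lemma cinner_zero_left [simp]: "cinner 0 x = 0" for x :: "'a::complex_hilbert"
  using cinner_diff_left[of x x x] by simp

lemma cinner_zero_right [simp]: "cinner x 0 = 0" for x :: "'a::complex_hilbert"
  using cinner_diff_right[of x x x] by simp

lemmas cinner_algebra =
  cinner_add_left cinner_add_right cinner_diff_left cinner_diff_right
  cinner_scaleC_left cinner_scaleC_right

lemma cinner_self: "cinner x x = complex_of_real ((norm x)\<^sup>2)" for x :: "'a::complex_hilbert"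
proof -
  have "Im (cinner x x) = 0"
    using cinner_commute[of x x] by (simp add: complex_eq_iff)
  then show ?thesis
    by (simp add: complex_eq_iff norm_eq_sqrt_cinner cinner_ge_zero)
qed

lemma norm_diff_sq:
  "(norm (x - y))\<^sup>2 = (norm x)\<^sup>2 - 2 * Re (cinner x y) + (norm y)\<^sup>2"
  for x y :: "'a::complex_hilbert"
proof -
  have "complex_of_real ((norm (x - y))\<^sup>2) = cinner x x - cinner x y - cinner y x + cinner y y"
    by (simp only: cinner_self[symmetric] cinner_algebra) simp
  also have "Re \<dots> = (norm x)\<^sup>2 - 2 * Re (cinner x y) + (norm y)\<^sup>2"
    using cinner_commute[of y x] by (simp add: cinner_self)
  finally show ?thesis
    by simp
qed

lemma norm_scaleC: "norm (a *\<^sub>C x) = cmod a * norm x" for x :: "'a::complex_hilbert"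
proof -
  have "complex_of_real ((norm (a *\<^sub>C x))\<^sup>2) = (a * cnj a) * complex_of_real ((norm x)\<^sup>2)"
    by (simp only: cinner_self[symmetric] cinner_scaleC_left cinner_scaleC_right mult_ac)
  also have "\<dots> = complex_of_real ((cmod a * norm x)\<^sup>2)"
    by (simp only: complex_norm_square[symmetric] of_real_mult[symmetric] power_mult_distrib)
  finally show ?thesis
    by (simp only: of_real_eq_iff power2_eq_iff_nonneg norm_ge_zero mult_nonneg_nonneg)
qed

text \<open>
  Subtracting from \<open>x\<close> its component along \<open>y\<close> lowers the squared norm by exactly this amount. Both
  the Cauchy--Schwarz inequality and the fact that a shortest vector is orthogonal are read off
  from this identity.
\<close>

lemma norm_diff_component_sq:
  fixes x y :: "'a::complex_hilbert"
  assumes "y \<noteq> 0"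
  shows "(norm (x - (cinner x y / cinner y y) *\<^sub>C y))\<^sup>2 =
    (norm x)\<^sup>2 - (cmod (cinner x y))\<^sup>2 / (norm y)\<^sup>2"
proof -
  define t where "t = cinner x y / cinner y y"
  have t: "t = cinner x y / complex_of_real ((norm y)\<^sup>2)"
    by (simp add: t_def cinner_self)
  have "Re (cinner x (t *\<^sub>C y)) = (cmod (cinner x y))\<^sup>2 / (norm y)\<^sup>2"
  proof -
    have "cinner x (t *\<^sub>C y) = (cinner x y * cnj (cinner x y)) / complex_of_real ((norm y)\<^sup>2)"
      by (simp add: t cinner_scaleC_right)
    also have "\<dots> = complex_of_real ((cmod (cinner x y))\<^sup>2 / (norm y)\<^sup>2)"
      by (simp only: complex_norm_square[symmetric] of_real_divide)
    finally show ?thesis by simp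
  qed
  moreover have "(norm (t *\<^sub>C y))\<^sup>2 = (cmod (cinner x y))\<^sup>2 / (norm y)\<^sup>2"
    using assms by (simp add: t norm_scaleC norm_divide power_mult_distrib power_divide norm_mult
        norm_power power2_eq_square field_simps)
  ultimately show ?thesis
    by (simp add: t_def[symmetric] norm_diff_sq)
qed

lemma Cauchy_Schwarz: "cmod (cinner x y) \<le> norm x * norm y" for x y :: "'a::complex_hilbert"
proof (cases "y = 0")
  case False
  have "(cmod (cinner x y))\<^sup>2 / (norm y)\<^sup>2 \<le> (norm x)\<^sup>2"
    using norm_diff_component_sq[OF False, of x] by (smt (verit) zero_le_power2)
  then have "(cmod (cinner x y))\<^sup>2 \<le> (norm x * norm y)\<^sup>2"
    using False by (simp add: field_simps power_mult_distrib)
  then show ?thesis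
    by (rule power2_le_imp_le) simp
qed simp

interpretation cinner: bounded_bilinear "cinner :: 'a::complex_hilbert \<Rightarrow> 'a \<Rightarrow> complex"
proof
  show "\<exists>K. \<forall>a b :: 'a. cmod (cinner a b) \<le> norm a * norm b * K"
    by (intro exI[of _ 1]) (simp add: Cauchy_Schwarz)
qed (simp_all add: cinner_algebra scaleR_scaleC scaleC_complex_def)

lemma bounded_linear_scaleC: "bounded_linear (\<lambda>x::'a::complex_hilbert. a *\<^sub>C x)"
proof (rule bounded_linear_intro[of _ "cmod a"])
  fix r :: real and x :: 'a
  show "a *\<^sub>C (r *\<^sub>R x) = r *\<^sub>R (a *\<^sub>C x)"
    by (simp add: scaleR_scaleC scaleC_scaleC mult.commute)
qed (simp_all add: scaleC_add_right norm_scaleC mult.commute)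

lemma orthogonal_dense_eq_zero:
  fixes v :: "'a::complex_hilbert"
  assumes "closure X = UNIV" and "\<And>x. x \<in> X \<Longrightarrow> cinner x v = 0"
  shows "v = 0"
proof -
  have "closed {x. cinner x v = 0}"
    by (intro closed_Collect_eq cinner.continuous_on continuous_intros)
  then have "closure X \<subseteq> {x. cinner x v = 0}"
    using assms(2) by (intro closure_minimal) auto
  then have "cinner v v = 0"
    using assms(1) by auto
  then show ?thesis
    by (simp add: cinner_eq_zero_iff)
qed

lemma cinner_right_ext:
  fixes x y :: "'a::complex_hilbert"
  assumes "\<And>w. cinner w x = cinner w y"
  shows "x = y"
  using orthogonal_dense_eq_zero[of UNIV "x - y"] assms by (simp add: cinner_diff_right)

text \<open>
  The classical minimising argument: by the parallelogram law a minimising sequence for the distance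
  from a point outside \<open>V\<close> is Cauchy, and the difference to its limit is a shortest vector, hence
  orthogonal to \<open>V\<close>.
\<close>

lemma proper_closed_subspace_orthogonal:
  fixes V :: "'a::complex_hilbert set"
  assumes "closed V" and "V \<noteq> UNIV" and "0 \<in> V"
    and add: "\<And>x y. x \<in> V \<Longrightarrow> y \<in> V \<Longrightarrow> x + y \<in> V"
    and scale: "\<And>a x. x \<in> V \<Longrightarrow> a *\<^sub>C x \<in> V"
  obtains w where "w \<noteq> 0" and "\<And>u. u \<in> V \<Longrightarrow> cinner u w = 0"
proof -
  obtain x where x: "x \<notin> V"
    using assms(2) by auto
  define d where "d = infdist x V"
  have d_le: "d \<le> norm (x - v)" if "v \<in> V" for v
    using that infdist_le[of v V x] by (simp add: d_def dist_norm)
  have d_nonneg: "0 \<le> d"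
    by (simp add: d_def infdist_nonneg)
  have "\<exists>v\<in>V. (norm (x - v))\<^sup>2 < d\<^sup>2 + inverse (Suc n)" for n
  proof -
    have "d < sqrt (d\<^sup>2 + inverse (Suc n))"
      using d_nonneg by (simp add: real_less_rsqrt)
    moreover have "s \<le> d" if "\<forall>v\<in>V. s \<le> norm (x - v)" for s
      using that \<open>0 \<in> V\<close> by (auto simp: d_def infdist_def dist_norm intro!: cINF_greatest)
    ultimately obtain v where v: "v \<in> V" "norm (x - v) < sqrt (d\<^sup>2 + inverse (Suc n))"
      by (meson not_less)
    then have "(norm (x - v))\<^sup>2 < (sqrt (d\<^sup>2 + inverse (Suc n)))\<^sup>2"
      by (intro power_strict_mono) auto
    then show ?thesis
      using v(1) by (intro bexI[of _ v]) auto
  qed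
  then obtain v where v: "\<And>n. v n \<in> V" and v_lt: "\<And>n. (norm (x - v n))\<^sup>2 < d\<^sup>2 + inverse (Suc n)"
    by metis
  have diff_le: "(norm (v m - v n))\<^sup>2 \<le> 2 * inverse (Suc m) + 2 * inverse (Suc n)" for m n
  proof -
    define p where "p = (1/2) *\<^sub>C (v m + v n)"
    have p: "p \<in> V"
      by (simp add: p_def add scale v)
    have "2 *\<^sub>R p = v m + v n"
      by (simp add: p_def scaleR_scaleC scaleC_scaleC scaleC_one)
    then have "(x - v m) + (x - v n) = 2 *\<^sub>R (x - p)"
      by (simp add: scaleR_diff_right scaleR_2)
    then have "4 * (norm (x - p))\<^sup>2 = (norm ((x - v m) + (x - v n)))\<^sup>2"
      by (simp add: power_mult_distrib)
    moreover have "(norm ((x - v m) - (x - v n)))\<^sup>2 + (norm ((x - v m) + (x - v n)))\<^sup>2 =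
        2 * (norm (x - v m))\<^sup>2 + 2 * (norm (x - v n))\<^sup>2"
      using norm_diff_sq[of "x - v m" "x - v n"] norm_diff_sq[of "x - v m" "- (x - v n)"]
      by (simp add: cinner_minus_right del: minus_diff_eq)
    moreover have "norm ((x - v m) - (x - v n)) = norm (v m - v n)"
      by (simp add: norm_minus_commute)
    moreover have "d\<^sup>2 \<le> (norm (x - p))\<^sup>2"
      using d_le[OF p] d_nonneg by (rule power_mono)
    ultimately show ?thesis
      using v_lt[of m] v_lt[of n] by simp
  qed
  have "Cauchy v"
  proof (rule metric_CauchyI)
    fix e :: real
    assume "0 < e"
    then obtain N where N: "inverse (Suc N) < e\<^sup>2 / 4"
      using reals_Archimedean[of "e\<^sup>2 / 4"] by auto
    have "dist (v m) (v n) < e" if "N \<le> m" "N \<le> n" for m n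
    proof -
      have "inverse (real (Suc m)) \<le> inverse (Suc N)" "inverse (real (Suc n)) \<le> inverse (Suc N)"
        using that by (auto intro!: le_imp_inverse_le)
      then have "(norm (v m - v n))\<^sup>2 < e\<^sup>2"
        using diff_le[of m n] N by linarith
      then show ?thesis
        using \<open>0 < e\<close> by (simp add: dist_norm power2_less_imp_less)
    qed
    then show "\<exists>N. \<forall>m\<ge>N. \<forall>n\<ge>N. dist (v m) (v n) < e"
      by blast
  qed
  then obtain p where lim: "v \<longlonglongrightarrow> p"
    using Cauchy_convergent convergent_def by blast
  have p: "p \<in> V"
    using \<open>closed V\<close> v lim closed_sequentially by blast
  have "(\<lambda>n. (norm (x - v n))\<^sup>2) \<longlonglongrightarrow> (norm (x - p))\<^sup>2"
    by (intro tendsto_intros lim)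
  moreover have "(\<lambda>n. d\<^sup>2 + inverse (real (Suc n))) \<longlonglongrightarrow> d\<^sup>2 + 0"
    by (intro tendsto_intros LIMSEQ_inverse_real_of_nat)
  ultimately have le_d: "(norm (x - p))\<^sup>2 \<le> d\<^sup>2"
    using v_lt by (metis (no_types, lifting) LIMSEQ_le add.right_neutral less_imp_le)
  show ?thesis
  proof
    show "x - p \<noteq> 0"
      using x p by auto
  next
    fix u
    assume u: "u \<in> V"
    show "cinner u (x - p) = 0"
    proof (cases "u = 0")
      case False
      define t where "t = cinner (x - p) u / cinner u u"
      have "p + t *\<^sub>C u \<in> V"
        by (intro add scale p u)
      then have "d\<^sup>2 \<le> (norm (x - p - t *\<^sub>C u))\<^sup>2"
        using d_le[of "p + t *\<^sub>C u"] d_nonneg by (simp add: power_mono algebra_simps)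
      then have "(cmod (cinner (x - p) u))\<^sup>2 / (norm u)\<^sup>2 \<le> 0"
        using norm_diff_component_sq[OF False, of "x - p"] le_d by (simp add: t_def)
      then have "cinner (x - p) u = 0"
        using False by (simp add: divide_le_0_iff)
      then show ?thesis
        using cinner_commute[of u "x - p"] by simp
    qed simp
  qed
qed

text \<open>
  The Hellinger--Toeplitz theorem. Because of the symmetry, the condition \<open>norm (R x) \<le> n\<close> is a
  closed condition on \<open>x\<close> even before continuity of \<open>R\<close> is known. Baire's theorem then gives a ball
  on which \<open>R\<close> is bounded.
\<close>

theorem Hellinger_Toeplitz:
  fixes R :: "'a::complex_hilbert \<Rightarrow> 'a"
  assumes sym: "\<And>x y. cinner (R x) y = cinner x (R y)"
  shows "\<exists>C. \<forall>x. norm (R x) \<le> C * norm x"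
proof -
  have R_add: "R (x + y) = R x + R y" for x y
    by (rule cinner_right_ext) (simp add: sym[symmetric] cinner_add_right)
  have R_scale: "R (r *\<^sub>R x) = r *\<^sub>R R x" for r x
    by (rule cinner_right_ext) (simp add: sym[symmetric] scaleR_scaleC cinner_scaleC_right)
  define E where "E n = {x. \<forall>y. cmod (cinner x (R y)) \<le> real n * norm y}" for n
  have E_iff: "x \<in> E n \<longleftrightarrow> norm (R x) \<le> real n" for x n
  proof
    assume "x \<in> E n"
    then have "cmod (cinner (R x) (R x)) \<le> real n * norm (R x)"
      by (simp add: E_def sym)
    then have "norm (R x) * norm (R x) \<le> real n * norm (R x)"
      by (simp add: cinner_self norm_power power2_eq_square norm_mult)
    then show "norm (R x) \<le> real n"
      by (cases "R x = 0") auto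
  next
    assume le: "norm (R x) \<le> real n"
    have "cmod (cinner x (R y)) \<le> real n * norm y" for y
    proof -
      have "cmod (cinner x (R y)) \<le> norm (R x) * norm y"
        using Cauchy_Schwarz[of "R x" y] by (simp add: sym)
      also have "\<dots> \<le> real n * norm y"
        using le by (intro mult_right_mono) auto
      finally show ?thesis .
    qed
    then show "x \<in> E n"
      by (simp add: E_def)
  qed
  have E_closed: "closed (E n)" for n
    unfolding E_def
    by (intro closed_Collect_all closed_Collect_le continuous_intros cinner.continuous_on)
  have "\<exists>n. interior (E n) \<noteq> {}"
  proof (rule ccontr)
    assume empty: "\<not> ?thesis"
    have "euclidean interior_of \<Union>(range E) = {}"
      using E_closed empty complete_UNIV
      by (intro Met_TC.metric_Baire_category_alt[unfolded mtopology_is_euclidean])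
         (auto simp: mcomplete_iff_complete)
    moreover have "\<Union>(range E) = UNIV"
      using E_iff real_arch_simple by (auto simp: set_eq_iff)
    ultimately show False
      by simp
  qed
  then obtain n x\<^sub>0 e where e: "0 < e" "ball x\<^sub>0 e \<subseteq> E n"
    by (meson ex_in_conv mem_interior)
  have R_small: "norm (R u) \<le> 2 * real n" if "norm u < e" for u
  proof -
    have "R u = R (x\<^sub>0 + u) - R x\<^sub>0"
      by (simp add: R_add)
    moreover have "x\<^sub>0 + u \<in> E n" "x\<^sub>0 \<in> E n"
      using e that by (auto simp: dist_norm subset_iff)
    ultimately show ?thesis
      using norm_triangle_ineq4[of "R (x\<^sub>0 + u)" "R x\<^sub>0"] by (simp add: E_iff)
  qed
  have "norm (R x) \<le> (4 * real n / e) * norm x" for x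
  proof (cases "x = 0")
    case True
    then show ?thesis
      using R_scale[of 0 x] by simp
  next
    case False
    define c where "c = e / (2 * norm x)"
    have "0 < c" and "norm (c *\<^sub>R x) < e"
      using e False by (auto simp: c_def)
    then have "c * norm (R x) \<le> 2 * real n"
      using R_small[of "c *\<^sub>R x"] by (simp add: R_scale)
    then show ?thesis
      using e False by (simp add: c_def field_simps)
  qed
  then show ?thesis
    by blast
qed

section \<open>Linear operators, resolvents and self-adjointness\<close>

lemma linear_op_add:
  assumes "linear_op A" and "(x, y) \<in> A" and "(x', y') \<in> A"
  shows "(x + x', y + y') \<in> A"
  using assms by (simp add: linear_op_def)

lemma linear_op_scaleC:
  assumes "linear_op A" and "(x, y) \<in> A"
  shows "(a *\<^sub>C x, a *\<^sub>C y) \<in> A"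
  using assms by (simp add: linear_op_def)

lemma linear_op_diff:
  assumes "linear_op A" and "(x, y) \<in> A" and "(x', y') \<in> A"
  shows "(x - x', y - y') \<in> A"
  using linear_op_add[OF assms(1,2) linear_op_scaleC[OF assms(1,3), of "-1"]]
  by (simp add: scaleC_minus_one)

lemma linear_op_zero: "linear_op A \<Longrightarrow> (0, 0) \<in> A"
  by (simp add: linear_op_def)

lemma linear_op_unique: "linear_op A \<Longrightarrow> (x, y) \<in> A \<Longrightarrow> (x, y') \<in> A \<Longrightarrow> y = y'"
  by (auto simp: linear_op_def single_valued_def)

lemma in_resolvent_op_iff: "(g, f) \<in> resolvent_op A z \<longleftrightarrow> (f, g + z *\<^sub>C f) \<in> A"
proof -
  have "(g, f) \<in> resolvent_op A z \<longleftrightarrow> (\<exists>f'. (f, f') \<in> A \<and> g = f' - z *\<^sub>C f)"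
    by (auto simp: resolvent_op_def op_minus_def scalar_op_def)
  also have "\<dots> \<longleftrightarrow> (f, g + z *\<^sub>C f) \<in> A"
    by (auto simp: algebra_simps)
  finally show ?thesis .
qed

lemma resolvent_set_surj:
  assumes "z \<in> resolvent_set A"
  obtains f where "(f, g + z *\<^sub>C f) \<in> A"
proof -
  have "g \<in> Domain (resolvent_op A z)"
    using assms by (simp add: resolvent_set_def)
  then show thesis
    using that by (auto simp: in_resolvent_op_iff)
qed

lemma resolvent_set_inj:
  assumes "z \<in> resolvent_set A" and "(f, g + z *\<^sub>C f) \<in> A" and "(h, g + z *\<^sub>C h) \<in> A"
  shows "f = h"
proof -
  have "(g, f) \<in> resolvent_op A z" "(g, h) \<in> resolvent_op A z"
    using assms(2,3) by (simp_all add: in_resolvent_op_iff)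
  then show ?thesis
    using assms(1) unfolding resolvent_set_def single_valued_def by blast
qed

lemma resolvent_set_bound:
  assumes "z \<in> resolvent_set A"
  obtains C where "\<And>f f'. (f, f') \<in> A \<Longrightarrow> norm f \<le> C * norm (f' - z *\<^sub>C f)"
proof -
  obtain C where C: "\<forall>(g, f) \<in> resolvent_op A z. norm f \<le> C * norm g"
    using assms by (auto simp: resolvent_set_def)
  have "norm f \<le> C * norm (f' - z *\<^sub>C f)" if "(f, f') \<in> A" for f f'
  proof -
    have "(f' - z *\<^sub>C f, f) \<in> resolvent_op A z"
      using that by (simp add: in_resolvent_op_iff)
    then show ?thesis
      using C by auto
  qed
  then show thesis
    using that by blast
qed

lemma self_adjoint_imp_symmetric:
  assumes "self_adjoint_op A" and "(f, f') \<in> A" and "(g, g') \<in> A"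
  shows "cinner f' g = cinner f g'"
proof -
  have "(g, g') \<in> adjoint_op A"
    using assms by (simp add: self_adjoint_op_def)
  then show ?thesis
    using assms(2) by (auto simp: adjoint_op_def)
qed

lemma self_adjoint_memberI:
  assumes "self_adjoint_op A" and "\<And>u v. (u, v) \<in> A \<Longrightarrow> cinner v y = cinner u x"
  shows "(y, x) \<in> A"
proof -
  have "(y, x) \<in> adjoint_op A"
    using assms(2) by (auto simp: adjoint_op_def)
  then show ?thesis
    using assms(1) by (simp add: self_adjoint_op_def)
qed

lemma self_adjoint_closed: "self_adjoint_op A \<Longrightarrow> (\<And>n. (x n, y n) \<in> A) \<Longrightarrow>
    x \<longlonglongrightarrow> p \<Longrightarrow> y \<longlonglongrightarrow> q \<Longrightarrow> (p, q) \<in> A"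
proof (rule self_adjoint_memberI)
  fix u v
  assume A: "self_adjoint_op A" "\<And>n. (x n, y n) \<in> A" "x \<longlonglongrightarrow> p" "y \<longlonglongrightarrow> q" "(u, v) \<in> A"
  have "cinner v (x n) = cinner u (y n)" for n
    using A(1,2,5) by (blast intro: self_adjoint_imp_symmetric)
  moreover have "(\<lambda>n. cinner v (x n)) \<longlonglongrightarrow> cinner v p"
    by (intro cinner.tendsto tendsto_const A)
  moreover have "(\<lambda>n. cinner u (y n)) \<longlonglongrightarrow> cinner u q"
    by (intro cinner.tendsto tendsto_const A)
  ultimately show "cinner v p = cinner u q"
    using LIMSEQ_unique by simp
qed

text \<open>This holds because \<open>cinner f' f\<close> is real.\<close>

lemma self_adjoint_norm_cnj:
  assumes A: "self_adjoint_op A" and f: "(f, f') \<in> A"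
  shows "norm (f' - cnj z *\<^sub>C f) = norm (f' - z *\<^sub>C f)"
proof -
  have "Im (cinner f' f) = 0"
    using self_adjoint_imp_symmetric[OF A f f] cinner_commute[of f f']
    by (simp add: complex_eq_iff)
  then have "(norm (f' - cnj z *\<^sub>C f))\<^sup>2 = (norm (f' - z *\<^sub>C f))\<^sup>2"
    by (simp add: norm_diff_sq norm_scaleC cinner_scaleC_right)
  then show ?thesis
    by simp
qed

text \<open>
  By equality of the norms, the lower bound for \<open>A - z\<close> is one for \<open>A - cnj z\<close> as well. Hence the
  latter has closed range, and a vector orthogonal to that range lies in the kernel of \<open>A - z\<close>,
  which is trivial.
\<close>

lemma self_adjoint_resolvent_cnj_surj:
  assumes A: "self_adjoint_op A" and z: "z \<in> resolvent_set A"
  obtains f where "(f, g + cnj z *\<^sub>C f) \<in> A"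
proof -
  have lin: "linear_op A"
    using A by (simp add: self_adjoint_op_def)
  obtain C where C: "\<And>f f'. (f, f') \<in> A \<Longrightarrow> norm f \<le> C * norm (f' - z *\<^sub>C f)"
    using resolvent_set_bound[OF z] by metis
  define V where "V = {f' - cnj z *\<^sub>C f | f f'. (f, f') \<in> A}"
  have VI: "f' - cnj z *\<^sub>C f \<in> V" if "(f, f') \<in> A" for f f'
    using that by (auto simp: V_def)
  have "V = UNIV"
  proof (rule ccontr)
    assume "V \<noteq> UNIV"
    moreover have "0 \<in> V"
      using VI[OF linear_op_zero[OF lin]] by simp
    moreover have "x + y \<in> V" if xy: "x \<in> V" "y \<in> V" for x y
    proof -
      obtain f f' h h' where "(f, f') \<in> A" "x = f' - cnj z *\<^sub>C f" "(h, h') \<in> A" "y = h' - cnj z *\<^sub>C h"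
        using xy by (auto simp: V_def)
      then show ?thesis
        using VI[OF linear_op_add[OF lin, of f f' h h']] by (simp add: scaleC_add_right add_diff_add)
    qed
    moreover have "a *\<^sub>C x \<in> V" if x: "x \<in> V" for a x
    proof -
      obtain f f' where "(f, f') \<in> A" "x = f' - cnj z *\<^sub>C f"
        using x by (auto simp: V_def)
      then show ?thesis
        using VI[OF linear_op_scaleC[OF lin, of f f' a]]
        by (simp add: scaleC_diff_right scaleC_scaleC mult.commute)
    qed
    moreover have "closed V"
      unfolding closed_sequential_limits
    proof (intro allI impI)
      fix x q
      assume "(\<forall>n. x n \<in> V) \<and> x \<longlonglongrightarrow> q"
      then have "\<And>n. x n \<in> V" and lim: "x \<longlonglongrightarrow> q"
        by auto
      then have "\<forall>n. \<exists>f f'. (f, f') \<in> A \<and> x n = f' - cnj z *\<^sub>C f"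
        unfolding V_def by blast
      then obtain f f' where f: "\<And>n. (f n, f' n) \<in> A" "\<And>n. x n = f' n - cnj z *\<^sub>C f n"
        by metis
      have diff: "norm (f m - f n) \<le> \<bar>C\<bar> * norm (x m - x n)" for m n
      proof -
        have mem: "(f m - f n, f' m - f' n) \<in> A"
          by (intro linear_op_diff lin f)
        have "x m - x n = (f' m - f' n) - cnj z *\<^sub>C (f m - f n)"
          by (simp add: f(2) scaleC_diff_right)
        then have "norm (f m - f n) \<le> C * norm (x m - x n)"
          using C[OF mem] self_adjoint_norm_cnj[OF A mem] by simp
        also have "\<dots> \<le> \<bar>C\<bar> * norm (x m - x n)"
          by (intro mult_right_mono) auto
        finally show ?thesis .
      qed
      have "Cauchy f"
      proof (rule metric_CauchyI)
        fix e :: real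
        assume "0 < e"
        then obtain N where N: "\<And>m n. N \<le> m \<Longrightarrow> N \<le> n \<Longrightarrow> dist (x m) (x n) < e / (\<bar>C\<bar> + 1)"
          using LIMSEQ_imp_Cauchy[OF lim] unfolding Cauchy_def
          by (metis abs_add_one_gt_zero add.commute zero_less_divide_iff)
        have "dist (f m) (f n) < e" if "N \<le> m" "N \<le> n" for m n
        proof -
          have "dist (f m) (f n) \<le> (\<bar>C\<bar> + 1) * dist (x m) (x n)"
            using diff[of m n] by (simp add: dist_norm distrib_right add_increasing2)
          also have "\<dots> < e"
            using N[OF that] by (simp add: field_simps)
          finally show ?thesis .
        qed
        then show "\<exists>N. \<forall>m\<ge>N. \<forall>n\<ge>N. dist (f m) (f n) < e"
          by blast
      qed
      then obtain p where p: "f \<longlonglongrightarrow> p"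
        using Cauchy_convergent convergent_def by blast
      have "(\<lambda>n. x n + cnj z *\<^sub>C f n) \<longlonglongrightarrow> q + cnj z *\<^sub>C p"
        by (intro tendsto_add lim bounded_linear.tendsto[OF bounded_linear_scaleC] p)
      then have "f' \<longlonglongrightarrow> q + cnj z *\<^sub>C p"
        by (simp add: f(2))
      then have "(p, q + cnj z *\<^sub>C p) \<in> A"
        using self_adjoint_closed[OF A f(1) p] by blast
      then show "q \<in> V"
        using VI by fastforce
    qed
    ultimately obtain w where w: "w \<noteq> 0" "\<And>u. u \<in> V \<Longrightarrow> cinner u w = 0"
      using proper_closed_subspace_orthogonal[of V] by metis
    have "(w, z *\<^sub>C w) \<in> A"
    proof (rule self_adjoint_memberI[OF A])
      fix u v
      assume "(u, v) \<in> A"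
      then show "cinner v w = cinner u (z *\<^sub>C w)"
        using w(2)[OF VI] by (simp add: cinner_diff_left cinner_scaleC_left cinner_scaleC_right)
    qed
    then show False
      using C[of w "z *\<^sub>C w"] w(1) by simp
  qed
  then have "g \<in> V"
    by simp
  then obtain f f' where "(f, f') \<in> A" "g = f' - cnj z *\<^sub>C f"
    by (auto simp: V_def)
  then show thesis
    using that[of f] by simp
qed

lemma self_adjoint_resolvent_set_cnj:
  assumes A: "self_adjoint_op A" and z: "z \<in> resolvent_set A"
  shows "cnj z \<in> resolvent_set A"
proof -
  have lin: "linear_op A"
    using A by (simp add: self_adjoint_op_def)
  obtain C where "\<And>f f'. (f, f') \<in> A \<Longrightarrow> norm f \<le> C * norm (f' - z *\<^sub>C f)"
    using resolvent_set_bound[OF z] by metis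
  then have C: "norm f \<le> C * norm (f' - cnj z *\<^sub>C f)" if "(f, f') \<in> A" for f f'
    using that by (simp add: self_adjoint_norm_cnj[OF A])
  have bound: "norm f \<le> C * norm g" if "(g, f) \<in> resolvent_op A (cnj z)" for g f
    using C that by (fastforce simp: in_resolvent_op_iff)
  have "f = h" if "(g, f) \<in> resolvent_op A (cnj z)" "(g, h) \<in> resolvent_op A (cnj z)" for f g h
  proof -
    have "(f - h, (g + cnj z *\<^sub>C f) - (g + cnj z *\<^sub>C h)) \<in> A"
      using that by (intro linear_op_diff lin) (simp_all add: in_resolvent_op_iff)
    then have "(0, f - h) \<in> resolvent_op A (cnj z)"
      by (simp add: in_resolvent_op_iff scaleC_diff_right)
    then show ?thesis
      using bound[of 0 "f - h"] by simp
  qed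
  then have "single_valued (resolvent_op A (cnj z))"
    by (auto simp: single_valued_def)
  moreover have "g \<in> Domain (resolvent_op A (cnj z))" for g
    by (rule self_adjoint_resolvent_cnj_surj[OF A z, of g]) (auto simp: Domain_iff in_resolvent_op_iff)
  then have "Domain (resolvent_op A (cnj z)) = UNIV"
    by blast
  moreover have "\<forall>(g, f) \<in> resolvent_op A (cnj z). norm f \<le> C * norm g"
    using bound by blast
  ultimately show ?thesis
    unfolding resolvent_set_def by blast
qed

text \<open>
  Surjectivity of \<open>A - z\<close> at a single real point makes a symmetric operator self-adjoint: an element
  of the graph of the adjoint differs from one of the graph of \<open>A\<close> by a vector that is orthogonal to
  the range of \<open>A - z\<close>. The inverse is symmetric and everywhere defined, hence bounded.
\<close>

lemma symmetric_surj_imp_self_adjoint: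
  assumes lin: "linear_op A" and sym: "symmetric_op A" and dense: "densely_defined A"
    and real: "z \<in> \<real>" and surj: "\<And>g. \<exists>f. (f, g + z *\<^sub>C f) \<in> A"
  shows "self_adjoint_op A" and "z \<in> resolvent_set A"
proof -
  have cnj_z: "cnj z = z"
    using real Reals_cnj_iff by blast
  have symD: "cinner f' g = cinner f g'" if "(f, f') \<in> A" "(g, g') \<in> A" for f f' g g'
    using sym that by (auto simp: symmetric_op_def)
  have adj: "f = y \<and> (y, x) \<in> A"
    if f: "(f, (x - z *\<^sub>C y) + z *\<^sub>C f) \<in> A" and yx: "\<And>u v. (u, v) \<in> A \<Longrightarrow> cinner v y = cinner u x"
    for x y f
  proof -
    have "cinner g (y - f) = 0" for g
    proof -
      obtain u where u: "(u, g + z *\<^sub>C u) \<in> A"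
        using surj by blast
      have "cinner (g + z *\<^sub>C u) y = cinner u x"
        "cinner (g + z *\<^sub>C u) f = cinner u ((x - z *\<^sub>C y) + z *\<^sub>C f)"
        using yx[OF u] symD[OF u f] by auto
      then have "cinner g y + z * cinner u y = cinner u x" "cinner g f + z * cinner u y = cinner u x"
        by (simp_all add: cinner_algebra cnj_z)
      then show ?thesis
        by (metis add_right_cancel cinner_diff_right right_minus_eq)
    qed
    then have "y - f = 0"
      using orthogonal_dense_eq_zero[of UNIV "y - f"] by simp
    then show ?thesis
      using f by simp
  qed
  have "adjoint_op A \<subseteq> A"
    using surj adj by (fastforce simp: adjoint_op_def)
  moreover have "A \<subseteq> adjoint_op A"
    using symD by (auto simp: adjoint_op_def)
  ultimately show "self_adjoint_op A"
    using lin dense by (auto simp: self_adjoint_op_def)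

  have inj: "f = h" if "(f, g + z *\<^sub>C f) \<in> A" "(h, g + z *\<^sub>C h) \<in> A" for f g h
    using adj[of f "g + z *\<^sub>C h" h] that symD by simp
  define R where "R g = (SOME f. (f, g + z *\<^sub>C f) \<in> A)" for g
  have R: "(R g, g + z *\<^sub>C R g) \<in> A" for g
    unfolding R_def using someI_ex[OF surj] .
  have "cinner (R g) h = cinner g (R h)" for g h
    using symD[OF R[of g] R[of h]] by (simp add: cinner_algebra cnj_z)
  then obtain C where C: "\<And>g. norm (R g) \<le> C * norm g"
    using Hellinger_Toeplitz[of R] by auto
  have "resolvent_op A z = {(g, R g) | g. True}"
    using R inj by (auto simp: in_resolvent_op_iff)
  then show "z \<in> resolvent_set A"
    using C by (auto simp: resolvent_set_def single_valued_def intro!: exI[of _ C])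
qed

section \<open>Quasi boundary triples\<close>

lemma in_gamma_field_iff:
  "(\<phi>, u) \<in> gamma_field T \<Gamma> z \<longleftrightarrow> (u, z *\<^sub>C u) \<in> T \<and> \<phi> = \<Gamma> u"
  by (auto simp: gamma_field_def op_on_def op_ker_def op_minus_def scalar_op_def)

lemma in_weyl_function_iff:
  "(\<phi>, m) \<in> weyl_function T \<Gamma>\<^sub>0 \<Gamma>\<^sub>1 z \<longleftrightarrow>
    (\<exists>u. (u, z *\<^sub>C u) \<in> T \<and> \<phi> = \<Gamma>\<^sub>0 u \<and> m = \<Gamma>\<^sub>1 u)"
  by (auto simp: weyl_function_def relcomp_unfold in_gamma_field_iff op_on_def)

lemma boundary_map_diff:
  assumes "linear_op (op_on D \<Gamma>)" and "f \<in> D" and "g \<in> D"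
  shows "\<Gamma> (f - g) = \<Gamma> f - \<Gamma> g"
  using linear_op_diff[OF assms(1), of f "\<Gamma> f" g "\<Gamma> g"] assms(2,3) by (auto simp: op_on_def)

lemma boundary_map_add:
  assumes "linear_op (op_on D \<Gamma>)" and "f \<in> D" and "g \<in> D"
  shows "\<Gamma> (f + g) = \<Gamma> f + \<Gamma> g"
  using linear_op_add[OF assms(1), of f "\<Gamma> f" g "\<Gamma> g"] assms(2,3) by (auto simp: op_on_def)

text \<open>
  Subtracting from \<open>f\<close> the element of \<open>ker \<Gamma>\<close> on which \<open>T - z\<close> takes the value \<open>(T - z) f\<close> leaves the
  boundary value unchanged; this is the decomposition \<open>dom T = ker \<Gamma> + ker (T - z)\<close>. It serves for both
  boundary maps.
\<close>

lemma boundary_value_in_defect_space: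
  assumes T: "linear_op T" and \<Gamma>: "linear_op (op_on (Domain T) \<Gamma>)"
    and z: "z \<in> resolvent_set (restrict_ker T \<Gamma>)" and f: "f \<in> Domain T"
  obtains u where "(u, z *\<^sub>C u) \<in> T" and "\<Gamma> u = \<Gamma> f"
proof -
  obtain f' where f': "(f, f') \<in> T"
    using f by auto
  obtain a where "(a, (f' - z *\<^sub>C f) + z *\<^sub>C a) \<in> restrict_ker T \<Gamma>"
    using resolvent_set_surj[OF z] .
  then have a: "(a, (f' - z *\<^sub>C f) + z *\<^sub>C a) \<in> T" "\<Gamma> a = 0"
    by (auto simp: restrict_ker_def)
  show thesis
  proof
    show "(f - a, z *\<^sub>C (f - a)) \<in> T"
      using linear_op_diff[OF T f' a(1)] by (simp add: scaleC_diff_right)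
    show "\<Gamma> (f - a) = \<Gamma> f"
      using boundary_map_diff[OF \<Gamma> f, of a] a by auto
  qed
qed

locale boundary_triple =
  fixes S T :: "('h::complex_hilbert \<times> 'h) set"
    and \<Gamma>\<^sub>0 \<Gamma>\<^sub>1 :: "'h \<Rightarrow> 'g::complex_hilbert"
  assumes triple: "quasi_boundary_triple S T \<Gamma>\<^sub>0 \<Gamma>\<^sub>1"
begin

abbreviation A\<^sub>0 :: "('h \<times> 'h) set"
  where "A\<^sub>0 \<equiv> restrict_ker T \<Gamma>\<^sub>0"

lemma linear_T: "linear_op T"
  and linear_\<Gamma>\<^sub>0: "linear_op (op_on (Domain T) \<Gamma>\<^sub>0)"
  and linear_\<Gamma>\<^sub>1: "linear_op (op_on (Domain T) \<Gamma>\<^sub>1)"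
  and self_adjoint_A\<^sub>0: "self_adjoint_op A\<^sub>0"
  and T_subset_adjoint: "T \<subseteq> adjoint_op S"
  and dense_boundary_values: "closure ((\<lambda>f. (\<Gamma>\<^sub>0 f, \<Gamma>\<^sub>1 f)) ` Domain T) = UNIV"
  using triple by (auto simp: quasi_boundary_triple_def)

lemma green:
  assumes "(f, f') \<in> T" and "(g, g') \<in> T"
  shows "cinner f' g - cinner f g' = cinner (\<Gamma>\<^sub>1 f) (\<Gamma>\<^sub>0 g) - cinner (\<Gamma>\<^sub>0 f) (\<Gamma>\<^sub>1 g)"
  using triple assms unfolding quasi_boundary_triple_def by fast

text \<open>The pair \<open>(v, 0)\<close> is orthogonal to the range of \<open>(\<Gamma>\<^sub>0, \<Gamma>\<^sub>1)\<close>, which is dense.\<close>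

lemma orthogonal_range_\<Gamma>\<^sub>0_eq_zero:
  assumes "\<And>f. f \<in> Domain T \<Longrightarrow> cinner (\<Gamma>\<^sub>0 f) v = 0"
  shows "v = 0"
proof -
  have "closed {p :: 'g \<times> 'g. cinner (fst p) v = 0}"
    by (intro closed_Collect_eq cinner.continuous_on continuous_intros)
  then have "closure ((\<lambda>f. (\<Gamma>\<^sub>0 f, \<Gamma>\<^sub>1 f)) ` Domain T) \<subseteq> {p. cinner (fst p) v = 0}"
    by (intro closure_minimal image_subsetI) (simp_all add: assms)
  then have "(v, 0) \<in> {p :: 'g \<times> 'g. cinner (fst p) v = 0}"
    unfolding dense_boundary_values by blast
  then show ?thesis
    by (simp add: cinner_eq_zero_iff)
qed

text \<open>
  Taking adjoints in \<open>A\<^sub>0 \<subseteq> T \<subseteq> S\<^sup>*\<close> gives \<open>S \<subseteq> A\<^sub>0\<close>, which settles \<open>\<Gamma>\<^sub>0\<close>. Symmetry of \<open>S\<close> against \<open>T\<close>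
  then leaves \<open>\<Gamma>\<^sub>1 f\<close> orthogonal to the range of \<open>\<Gamma>\<^sub>0\<close>.
\<close>

lemma minimal_operator_boundary_values:
  assumes f: "(f, f') \<in> S"
  shows "(f, f') \<in> T" and "\<Gamma>\<^sub>0 f = 0" and "\<Gamma>\<^sub>1 f = 0"
proof -
  have S_T: "cinner f' u = cinner f v" if "(u, v) \<in> T" for u v
    using T_subset_adjoint that f by (auto simp: adjoint_op_def)
  have "(f, f') \<in> A\<^sub>0"
  proof (rule self_adjoint_memberI[OF self_adjoint_A\<^sub>0])
    fix u v
    assume "(u, v) \<in> A\<^sub>0"
    then have "cinner f' u = cinner f v"
      by (intro S_T) (simp add: restrict_ker_def)
    then show "cinner v f = cinner u f'"
      using cinner_commute by metis
  qed
  then show T: "(f, f') \<in> T" and \<Gamma>\<^sub>0: "\<Gamma>\<^sub>0 f = 0"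
    by (auto simp: restrict_ker_def)
  show "\<Gamma>\<^sub>1 f = 0"
  proof (rule orthogonal_range_\<Gamma>\<^sub>0_eq_zero)
    fix g
    assume "g \<in> Domain T"
    then obtain g' where g: "(g, g') \<in> T"
      by auto
    have "cinner (\<Gamma>\<^sub>1 f) (\<Gamma>\<^sub>0 g) = 0"
      using green[OF T g] S_T[OF g] by (simp add: \<Gamma>\<^sub>0)
    then show "cinner (\<Gamma>\<^sub>0 g) (\<Gamma>\<^sub>1 f) = 0"
      using cinner_commute[of "\<Gamma>\<^sub>0 g"] by simp
  qed
qed

lemma \<gamma>_field_inj:
  assumes "z \<in> resolvent_set A\<^sub>0" and "(u, z *\<^sub>C u) \<in> T" and "(v, z *\<^sub>C v) \<in> T" and "\<Gamma>\<^sub>0 u = \<Gamma>\<^sub>0 v"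
  shows "u = v"
proof -
  have "(u - v, 0 + z *\<^sub>C (u - v)) \<in> T"
    using linear_op_diff[OF linear_T assms(2,3)] by (simp add: scaleC_diff_right)
  moreover have "\<Gamma>\<^sub>0 (u - v) = 0"
    using boundary_map_diff[OF linear_\<Gamma>\<^sub>0, of u v] assms by auto
  moreover have "(0, 0 + z *\<^sub>C 0) \<in> A\<^sub>0"
    using self_adjoint_A\<^sub>0 linear_op_zero by (auto simp: self_adjoint_op_def)
  ultimately have "u - v = 0"
    using resolvent_set_inj[OF assms(1), of "u - v" 0 0] by (simp add: restrict_ker_def)
  then show ?thesis
    by simp
qed

text \<open>
  In operator form: the adjoint of \<open>\<gamma> (cnj z)\<close> is \<open>\<Gamma>\<^sub>1\<close> applied to the resolvent of \<open>A\<^sub>0\<close> at \<open>z\<close>. Green's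
  identity between \<open>ker (T - cnj z)\<close> and \<open>dom A\<^sub>0\<close> shows that the latter is an adjoint; there is
  no other one because \<open>\<gamma> (cnj z)\<close> is defined on the dense set \<open>ran \<Gamma>\<^sub>0\<close>.
\<close>

lemma in_adjoint_gamma_field_iff:
  assumes z: "z \<in> resolvent_set A\<^sub>0"
  shows "(g, c) \<in> adjoint_op (gamma_field T \<Gamma>\<^sub>0 (cnj z)) \<longleftrightarrow>
    (\<exists>a. (g, a) \<in> resolvent_op A\<^sub>0 z \<and> c = \<Gamma>\<^sub>1 a)"
proof -
  have adj: "(g, c) \<in> adjoint_op (gamma_field T \<Gamma>\<^sub>0 (cnj z)) \<longleftrightarrow>
      (\<forall>u. (u, cnj z *\<^sub>C u) \<in> T \<longrightarrow> cinner u g = cinner (\<Gamma>\<^sub>0 u) c)" for c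
    by (auto simp: adjoint_op_def in_gamma_field_iff)
  have green_a: "cinner u g = cinner (\<Gamma>\<^sub>0 u) (\<Gamma>\<^sub>1 a)"
    if "(g, a) \<in> resolvent_op A\<^sub>0 z" "(u, cnj z *\<^sub>C u) \<in> T" for a u
  proof -
    have "(a, g + z *\<^sub>C a) \<in> T" "\<Gamma>\<^sub>0 a = 0"
      using that by (auto simp: in_resolvent_op_iff restrict_ker_def)
    then show ?thesis
      using green[OF that(2)] by (fastforce simp: cinner_algebra)
  qed
  show ?thesis
  proof
    assume c: "(g, c) \<in> adjoint_op (gamma_field T \<Gamma>\<^sub>0 (cnj z))"
    obtain a where a: "(g, a) \<in> resolvent_op A\<^sub>0 z"
      using resolvent_set_surj[OF z] by (metis in_resolvent_op_iff)
    have "c - \<Gamma>\<^sub>1 a = 0"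
    proof (rule orthogonal_range_\<Gamma>\<^sub>0_eq_zero)
      fix f
      assume "f \<in> Domain T"
      then obtain u where u: "(u, cnj z *\<^sub>C u) \<in> T" "\<Gamma>\<^sub>0 u = \<Gamma>\<^sub>0 f"
        using boundary_value_in_defect_space[OF linear_T linear_\<Gamma>\<^sub>0
            self_adjoint_resolvent_set_cnj[OF self_adjoint_A\<^sub>0 z]] by blast
      then have "cinner (\<Gamma>\<^sub>0 u) c = cinner (\<Gamma>\<^sub>0 u) (\<Gamma>\<^sub>1 a)"
        using c green_a[OF a] by (auto simp: adj)
      then show "cinner (\<Gamma>\<^sub>0 f) (c - \<Gamma>\<^sub>1 a) = 0"
        by (simp add: u(2) cinner_diff_right)
    qed
    then show "\<exists>a. (g, a) \<in> resolvent_op A\<^sub>0 z \<and> c = \<Gamma>\<^sub>1 a"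
      using a by auto
  next
    assume "\<exists>a. (g, a) \<in> resolvent_op A\<^sub>0 z \<and> c = \<Gamma>\<^sub>1 a"
    then show "(g, c) \<in> adjoint_op (gamma_field T \<Gamma>\<^sub>0 (cnj z))"
      using green_a by (auto simp only: adj)
  qed
qed

text \<open>
  For real \<open>z\<close> Green's identity makes \<open>M z\<close> a densely defined symmetric operator. Therefore its
  closure is single-valued and extends \<open>M z\<close> without changing it on \<open>ran \<Gamma>\<^sub>0\<close>.
\<close>

lemma closure_weyl_function_value:
  assumes z: "z \<in> resolvent_set A\<^sub>0" and real: "z \<in> \<real>"
    and m: "(\<psi>, m) \<in> closure (weyl_function T \<Gamma>\<^sub>0 \<Gamma>\<^sub>1 z)"
    and b: "(b, z *\<^sub>C b) \<in> T" "\<Gamma>\<^sub>0 b = \<psi>"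
  shows "m = \<Gamma>\<^sub>1 b"
proof -
  have cnj_z: "cnj z = z"
    using real Reals_cnj_iff by blast
  have sym: "cinner (\<Gamma>\<^sub>0 u) (\<Gamma>\<^sub>1 v) = cinner (\<Gamma>\<^sub>1 u) (\<Gamma>\<^sub>0 v)"
    if "(u, z *\<^sub>C u) \<in> T" "(v, z *\<^sub>C v) \<in> T" for u v
    using green[OF that] by (simp add: cinner_algebra cnj_z)
  have "m - \<Gamma>\<^sub>1 b = 0"
  proof (rule orthogonal_range_\<Gamma>\<^sub>0_eq_zero)
    fix f
    assume "f \<in> Domain T"
    then obtain u where u: "(u, z *\<^sub>C u) \<in> T" "\<Gamma>\<^sub>0 u = \<Gamma>\<^sub>0 f"
      using boundary_value_in_defect_space[OF linear_T linear_\<Gamma>\<^sub>0 z] by blast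
    have "closed {p. cinner (\<Gamma>\<^sub>0 u) (snd p) = cinner (\<Gamma>\<^sub>1 u) (fst p)}"
      by (intro closed_Collect_eq cinner.continuous_on continuous_intros)
    then have "closure (weyl_function T \<Gamma>\<^sub>0 \<Gamma>\<^sub>1 z) \<subseteq>
        {p. cinner (\<Gamma>\<^sub>0 u) (snd p) = cinner (\<Gamma>\<^sub>1 u) (fst p)}"
      using sym[OF u(1)] by (intro closure_minimal) (auto simp: in_weyl_function_iff)
    then have "cinner (\<Gamma>\<^sub>0 u) m = cinner (\<Gamma>\<^sub>1 u) \<psi>"
      using m by auto
    then show "cinner (\<Gamma>\<^sub>0 f) (m - \<Gamma>\<^sub>1 b) = 0"
      using sym[OF u(1) b(1)] by (simp add: u(2)[symmetric] b(2) cinner_diff_right)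
  qed
  then show ?thesis
    by simp
qed

section \<open>The extension given by a boundary operator\<close>

lemma linear_extension:
  assumes B: "linear_op B"
  shows "linear_op (extension_op T \<Gamma>\<^sub>0 \<Gamma>\<^sub>1 B)"
proof -
  have "(f + g, f' + g') \<in> extension_op T \<Gamma>\<^sub>0 \<Gamma>\<^sub>1 B"
    if "(f, f') \<in> extension_op T \<Gamma>\<^sub>0 \<Gamma>\<^sub>1 B" "(g, g') \<in> extension_op T \<Gamma>\<^sub>0 \<Gamma>\<^sub>1 B" for f f' g g'
  proof -
    have fg: "(f, f') \<in> T" "(g, g') \<in> T" "(\<Gamma>\<^sub>1 f, \<Gamma>\<^sub>0 f) \<in> B" "(\<Gamma>\<^sub>1 g, \<Gamma>\<^sub>0 g) \<in> B"
      using that by (auto simp: extension_op_def)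
    have "f \<in> Domain T" "g \<in> Domain T"
      using fg by auto
    then show ?thesis
      using linear_op_add[OF linear_T fg(1,2)] linear_op_add[OF B fg(3,4)]
      by (simp add: extension_op_def boundary_map_add[OF linear_\<Gamma>\<^sub>0] boundary_map_add[OF linear_\<Gamma>\<^sub>1])
  qed
  moreover have "(a *\<^sub>C f, a *\<^sub>C f') \<in> extension_op T \<Gamma>\<^sub>0 \<Gamma>\<^sub>1 B"
    if "(f, f') \<in> extension_op T \<Gamma>\<^sub>0 \<Gamma>\<^sub>1 B" for a f f'
  proof -
    have f: "(f, f') \<in> T" "(\<Gamma>\<^sub>1 f, \<Gamma>\<^sub>0 f) \<in> B"
      using that by (auto simp: extension_op_def)
    have "\<Gamma> (a *\<^sub>C f) = a *\<^sub>C \<Gamma> f" if "linear_op (op_on (Domain T) \<Gamma>)" for \<Gamma> :: "'h \<Rightarrow> 'g"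
      using linear_op_scaleC[OF that, of f "\<Gamma> f" a] DomainI[OF f(1)] by (auto simp: op_on_def)
    then show ?thesis
      using linear_op_scaleC[OF linear_T f(1), of a] linear_op_scaleC[OF B f(2), of a]
      by (simp add: extension_op_def linear_\<Gamma>\<^sub>0 linear_\<Gamma>\<^sub>1)
  qed
  moreover have "(0, 0) \<in> extension_op T \<Gamma>\<^sub>0 \<Gamma>\<^sub>1 B"
    using linear_op_zero[OF linear_T] linear_op_zero[OF B] linear_op_zero[OF linear_\<Gamma>\<^sub>0]
      linear_op_zero[OF linear_\<Gamma>\<^sub>1]
    by (auto simp: extension_op_def op_on_def)
  moreover have "single_valued (extension_op T \<Gamma>\<^sub>0 \<Gamma>\<^sub>1 B)"
    using linear_op_unique[OF linear_T] by (auto simp: extension_op_def single_valued_def)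
  ultimately show ?thesis
    by (simp add: linear_op_def)
qed

lemma symmetric_extension:
  assumes "symmetric_op B"
  shows "symmetric_op (extension_op T \<Gamma>\<^sub>0 \<Gamma>\<^sub>1 B)"
proof -
  have "cinner f' g = cinner f g'"
    if "(f, f') \<in> T" "(\<Gamma>\<^sub>1 f, \<Gamma>\<^sub>0 f) \<in> B" "(g, g') \<in> T" "(\<Gamma>\<^sub>1 g, \<Gamma>\<^sub>0 g) \<in> B" for f f' g g'
  proof -
    have "cinner (\<Gamma>\<^sub>0 f) (\<Gamma>\<^sub>1 g) = cinner (\<Gamma>\<^sub>1 f) (\<Gamma>\<^sub>0 g)"
      using assms that by (auto simp: symmetric_op_def)
    then show ?thesis
      using green[OF that(1,3)] by simp
  qed
  then show ?thesis
    by (auto simp: symmetric_op_def extension_op_def)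
qed

lemma minimal_operator_subset_extension:
  assumes "linear_op B"
  shows "S \<subseteq> extension_op T \<Gamma>\<^sub>0 \<Gamma>\<^sub>1 B"
  using minimal_operator_boundary_values linear_op_zero[OF assms]
  by (auto simp: extension_op_def)

text \<open>
  Why the second alternative leads back to the first: if \<open>z\<close> is in the resolvent set of the
  restriction of \<open>T\<close> to \<open>ker \<Gamma>\<^sub>1\<close>, then every element of \<open>ran \<Gamma>\<^sub>1\<close> is a value \<open>\<Gamma>\<^sub>1 u\<close> with
  \<open>u \<in> ker (T - z)\<close>. So it lies in the range of \<open>M z\<close>, whose image under \<open>B\<close> is controlled.
\<close>

lemma boundary_operator_range:
  assumes range: "B `` (Range (closure (weyl_function T \<Gamma>\<^sub>0 \<Gamma>\<^sub>1 z)) \<inter> Domain B) \<subseteq> \<Gamma>\<^sub>0 ` Domain T"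
    and alt: "B `` (\<Gamma>\<^sub>1 ` Domain T) \<subseteq> \<Gamma>\<^sub>0 ` Domain T \<or> z \<in> resolvent_set (restrict_ker T \<Gamma>\<^sub>1)"
  shows "B `` (\<Gamma>\<^sub>1 ` Domain T) \<subseteq> \<Gamma>\<^sub>0 ` Domain T"
  using alt
proof
  assume z: "z \<in> resolvent_set (restrict_ker T \<Gamma>\<^sub>1)"
  have "\<Gamma>\<^sub>1 f \<in> Range (closure (weyl_function T \<Gamma>\<^sub>0 \<Gamma>\<^sub>1 z))" if "f \<in> Domain T" for f
  proof -
    obtain u where u: "(u, z *\<^sub>C u) \<in> T" "\<Gamma>\<^sub>1 u = \<Gamma>\<^sub>1 f"
      using boundary_value_in_defect_space[OF linear_T linear_\<Gamma>\<^sub>1 z \<open>f \<in> Domain T\<close>] .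
    then have "(\<Gamma>\<^sub>0 u, \<Gamma>\<^sub>1 f) \<in> weyl_function T \<Gamma>\<^sub>0 \<Gamma>\<^sub>1 z"
      by (auto simp: in_weyl_function_iff)
    then show ?thesis
      using closure_subset by blast
  qed
  then show ?thesis
    using range by blast
qed

text \<open>
  To solve \<open>(A\<^bsub>[B]\<^esub> - z) f = g\<close>, put \<open>f = a + b\<close> with \<open>a\<close> the solution for \<open>A\<^sub>0\<close> and \<open>b \<in> ker (T - z)\<close>. With
  \<open>\<psi> = \<Gamma>\<^sub>0 b\<close> the boundary condition becomes \<open>\<psi> - B (M z \<psi>) = B (\<Gamma>\<^sub>1 a)\<close>. The assumption on the point 1
  provides a solution \<open>\<psi>\<close> of the same equation for the closure of \<open>M z\<close>; the range conditions force \<open>\<psi>\<close> back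
  into \<open>ran \<Gamma>\<^sub>0\<close>, where the closure coincides with \<open>M z\<close>.
\<close>

lemma extension_surj:
  assumes B: "linear_op B" and z: "z \<in> resolvent_set A\<^sub>0" and real: "z \<in> \<real>"
    and one: "1 \<in> resolvent_set (B \<circ>\<^sub>o closure (weyl_function T \<Gamma>\<^sub>0 \<Gamma>\<^sub>1 z))"
    and range: "B `` (Range (closure (weyl_function T \<Gamma>\<^sub>0 \<Gamma>\<^sub>1 z)) \<inter> Domain B) \<subseteq> \<Gamma>\<^sub>0 ` Domain T"
    and dom: "\<Gamma>\<^sub>1 ` Domain T \<subseteq> Domain B"
    and range': "B `` (\<Gamma>\<^sub>1 ` Domain T) \<subseteq> \<Gamma>\<^sub>0 ` Domain T"
  shows "\<exists>f. (f, g + z *\<^sub>C f) \<in> extension_op T \<Gamma>\<^sub>0 \<Gamma>\<^sub>1 B"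
proof -
  obtain a where "(a, g + z *\<^sub>C a) \<in> A\<^sub>0"
    using resolvent_set_surj[OF z] .
  then have a: "(a, g + z *\<^sub>C a) \<in> T" "\<Gamma>\<^sub>0 a = 0"
    by (auto simp: restrict_ker_def)
  then have a_dom: "a \<in> Domain T"
    by auto
  then obtain d where d: "(\<Gamma>\<^sub>1 a, d) \<in> B"
    using dom by blast
  \<comment> \<open>The resolvent is that of \<open>B M - 1\<close>, not of \<open>1 - B M\<close>; hence it is applied to \<open>- d\<close>.\<close>
  obtain \<psi> where "(\<psi>, - d + 1 *\<^sub>C \<psi>) \<in> B \<circ>\<^sub>o closure (weyl_function T \<Gamma>\<^sub>0 \<Gamma>\<^sub>1 z)"
    using resolvent_set_surj[OF one] .
  then obtain m where m: "(\<psi>, m) \<in> closure (weyl_function T \<Gamma>\<^sub>0 \<Gamma>\<^sub>1 z)" "(m, \<psi> - d) \<in> B"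
    by (auto simp: scaleC_one)
  have "\<psi> - d \<in> \<Gamma>\<^sub>0 ` Domain T" "d \<in> \<Gamma>\<^sub>0 ` Domain T"
    using range range' m d a_dom by blast+
  then obtain h k where hk: "h \<in> Domain T" "k \<in> Domain T" "\<psi> - d = \<Gamma>\<^sub>0 h" "d = \<Gamma>\<^sub>0 k"
    by blast
  have "\<Gamma>\<^sub>0 (h + k) = \<psi>"
    using boundary_map_add[OF linear_\<Gamma>\<^sub>0 hk(1,2)] by (simp only: hk(3,4)[symmetric] diff_add_cancel)
  moreover have "h + k \<in> Domain T"
    using hk(1,2) linear_op_add[OF linear_T] by blast
  ultimately obtain b where b: "(b, z *\<^sub>C b) \<in> T" "\<Gamma>\<^sub>0 b = \<psi>"
    using boundary_value_in_defect_space[OF linear_T linear_\<Gamma>\<^sub>0 z] by metis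
  have b_dom: "b \<in> Domain T"
    using b by auto
  have "m = \<Gamma>\<^sub>1 b"
    using closure_weyl_function_value[OF z real m(1) b] .
  then have "(\<Gamma>\<^sub>1 (a + b), \<Gamma>\<^sub>0 (a + b)) \<in> B"
    using linear_op_add[OF B d m(2)] a(2) b(2)
    by (simp add: boundary_map_add[OF linear_\<Gamma>\<^sub>0 a_dom b_dom] boundary_map_add[OF linear_\<Gamma>\<^sub>1 a_dom b_dom])
  moreover have "(a + b, g + z *\<^sub>C (a + b)) \<in> T"
    using linear_op_add[OF linear_T a(1) b(1)] by (simp add: scaleC_add_right add.assoc)
  ultimately show ?thesis
    by (auto simp: extension_op_def)
qed

text \<open>
  Krein's formula is the same splitting \<open>f = a + b\<close> read as an equality of graphs: \<open>a\<close> is the first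
  summand, \<open>\<Gamma>\<^sub>1 a\<close> is the value of the adjoint of \<open>\<gamma> (cnj z)\<close> at \<open>g\<close>, and \<open>b\<close> is recovered from
  \<open>\<Gamma>\<^sub>0 b = \<Gamma>\<^sub>0 f\<close>, which by linearity of \<open>B\<close> solves \<open>\<Gamma>\<^sub>0 b - B (\<Gamma>\<^sub>1 b) = B (\<Gamma>\<^sub>1 a)\<close>.
\<close>

theorem Krein_formula:
  assumes B: "linear_op B" and dom: "\<Gamma>\<^sub>1 ` Domain T \<subseteq> Domain B" and z: "z \<in> resolvent_set A\<^sub>0"
  shows "resolvent_op (extension_op T \<Gamma>\<^sub>0 \<Gamma>\<^sub>1 B) z =
    resolvent_op A\<^sub>0 z +\<^sub>o
      gamma_field T \<Gamma>\<^sub>0 z \<circ>\<^sub>o converse (Id -\<^sub>o B \<circ>\<^sub>o weyl_function T \<Gamma>\<^sub>0 \<Gamma>\<^sub>1 z)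
        \<circ>\<^sub>o B \<circ>\<^sub>o adjoint_op (gamma_field T \<Gamma>\<^sub>0 (cnj z))" (is "?L = ?P +\<^sub>o ?Q")
proof -
  have P: "(g, a) \<in> ?P \<longleftrightarrow> (a, g + z *\<^sub>C a) \<in> T \<and> \<Gamma>\<^sub>0 a = 0" for g a
    by (simp add: in_resolvent_op_iff restrict_ker_def)
  have P_unique: "a = a'" if "(g, a) \<in> ?P" "(g, a') \<in> ?P" for g a a'
    using resolvent_set_inj[OF z] that by (simp add: in_resolvent_op_iff)
  have Q: "(g, b) \<in> ?Q \<longleftrightarrow> (\<exists>a d. (g, a) \<in> ?P \<and> (\<Gamma>\<^sub>1 a, d) \<in> B \<and>
      (b, z *\<^sub>C b) \<in> T \<and> (\<Gamma>\<^sub>1 b, \<Gamma>\<^sub>0 b - d) \<in> B)" for g b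
  proof
    assume "(g, b) \<in> ?Q"
    then obtain c d e w where c: "(g, c) \<in> adjoint_op (gamma_field T \<Gamma>\<^sub>0 (cnj z))" "(c, d) \<in> B"
      and w: "(e, w) \<in> B \<circ>\<^sub>o weyl_function T \<Gamma>\<^sub>0 \<Gamma>\<^sub>1 z" "d = e - w"
      and b: "(e, b) \<in> gamma_field T \<Gamma>\<^sub>0 z"
      unfolding op_minus_def by blast
    obtain a where "(g, a) \<in> ?P" "c = \<Gamma>\<^sub>1 a"
      using c(1) in_adjoint_gamma_field_iff[OF z] by blast
    moreover obtain u where u: "(u, z *\<^sub>C u) \<in> T" "e = \<Gamma>\<^sub>0 u" "(\<Gamma>\<^sub>1 u, w) \<in> B"
      using w(1) by (auto simp: in_weyl_function_iff)
    moreover have "(b, z *\<^sub>C b) \<in> T" "e = \<Gamma>\<^sub>0 b"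
      using b by (auto simp: in_gamma_field_iff)
    moreover from this have "u = b"
      using \<gamma>_field_inj[OF z u(1)] u(2) by metis
    ultimately show "\<exists>a d. (g, a) \<in> ?P \<and> (\<Gamma>\<^sub>1 a, d) \<in> B \<and>
        (b, z *\<^sub>C b) \<in> T \<and> (\<Gamma>\<^sub>1 b, \<Gamma>\<^sub>0 b - d) \<in> B"
      using c(2) w(2) by (intro exI[of _ a] exI[of _ d]) simp
  next
    assume "\<exists>a d. (g, a) \<in> ?P \<and> (\<Gamma>\<^sub>1 a, d) \<in> B \<and>
        (b, z *\<^sub>C b) \<in> T \<and> (\<Gamma>\<^sub>1 b, \<Gamma>\<^sub>0 b - d) \<in> B"
    then obtain a d where a: "(g, a) \<in> ?P" "(\<Gamma>\<^sub>1 a, d) \<in> B"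
      and b: "(b, z *\<^sub>C b) \<in> T" "(\<Gamma>\<^sub>1 b, \<Gamma>\<^sub>0 b - d) \<in> B"
      by blast
    have "(g, \<Gamma>\<^sub>1 a) \<in> adjoint_op (gamma_field T \<Gamma>\<^sub>0 (cnj z))"
      using a(1) in_adjoint_gamma_field_iff[OF z] by blast
    moreover have "(\<Gamma>\<^sub>0 b, b) \<in> gamma_field T \<Gamma>\<^sub>0 z"
      using b(1) by (simp add: in_gamma_field_iff)
    moreover have "(\<Gamma>\<^sub>0 b, \<Gamma>\<^sub>0 b - d) \<in> B \<circ>\<^sub>o weyl_function T \<Gamma>\<^sub>0 \<Gamma>\<^sub>1 z"
      using b by (intro relcompI[of _ "\<Gamma>\<^sub>1 b"]) (auto simp: in_weyl_function_iff)
    then have "(\<Gamma>\<^sub>0 b, \<Gamma>\<^sub>0 b - (\<Gamma>\<^sub>0 b - d)) \<in> Id -\<^sub>o B \<circ>\<^sub>o weyl_function T \<Gamma>\<^sub>0 \<Gamma>\<^sub>1 z"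
      unfolding op_minus_def by blast
    then have "(d, \<Gamma>\<^sub>0 b) \<in> converse (Id -\<^sub>o B \<circ>\<^sub>o weyl_function T \<Gamma>\<^sub>0 \<Gamma>\<^sub>1 z)"
      by simp
    ultimately show "(g, b) \<in> ?Q"
      using a(2) by blast
  qed
  have "(g, f) \<in> ?L \<longleftrightarrow> (g, f) \<in> ?P +\<^sub>o ?Q" for g f
  proof
    assume "(g, f) \<in> ?L"
    then have f: "(f, g + z *\<^sub>C f) \<in> T" "(\<Gamma>\<^sub>1 f, \<Gamma>\<^sub>0 f) \<in> B"
      by (auto simp: in_resolvent_op_iff extension_op_def)
    obtain a where a_P: "(g, a) \<in> ?P"
      using resolvent_set_surj[OF z] by (metis in_resolvent_op_iff)
    then have a: "(a, g + z *\<^sub>C a) \<in> T" "\<Gamma>\<^sub>0 a = 0"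
      by (auto simp: P)
    have doms: "f \<in> Domain T" "a \<in> Domain T"
      using f a by auto
    then obtain d where d: "(\<Gamma>\<^sub>1 a, d) \<in> B"
      using dom by blast
    have "(f - a, z *\<^sub>C (f - a)) \<in> T"
      using linear_op_diff[OF linear_T f(1) a(1)] by (simp add: scaleC_diff_right)
    moreover have "(\<Gamma>\<^sub>1 (f - a), \<Gamma>\<^sub>0 (f - a) - d) \<in> B"
      using linear_op_diff[OF B f(2) d] a(2)
      by (simp add: boundary_map_diff[OF linear_\<Gamma>\<^sub>0 doms] boundary_map_diff[OF linear_\<Gamma>\<^sub>1 doms])
    ultimately have "(g, f - a) \<in> ?Q"
      using a_P d Q by blast
    then have "(g, a + (f - a)) \<in> ?P +\<^sub>o ?Q"
      using a_P unfolding op_plus_def by blast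
    then show "(g, f) \<in> ?P +\<^sub>o ?Q"
      by simp
  next
    assume "(g, f) \<in> ?P +\<^sub>o ?Q"
    then obtain a b where a_P: "(g, a) \<in> ?P" and "(g, b) \<in> ?Q" and f: "f = a + b"
      unfolding op_plus_def by blast
    then obtain a' d where "(g, a') \<in> ?P" "(\<Gamma>\<^sub>1 a', d) \<in> B"
      and b: "(b, z *\<^sub>C b) \<in> T" "(\<Gamma>\<^sub>1 b, \<Gamma>\<^sub>0 b - d) \<in> B"
      using Q by blast
    then have d: "(\<Gamma>\<^sub>1 a, d) \<in> B"
      using P_unique[OF a_P] by blast
    have a: "(a, g + z *\<^sub>C a) \<in> T" "\<Gamma>\<^sub>0 a = 0"
      using a_P by (auto simp: P)
    have doms: "a \<in> Domain T" "b \<in> Domain T"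
      using a b by auto
    have "(f, g + z *\<^sub>C f) \<in> T"
      using linear_op_add[OF linear_T a(1) b(1)] by (simp add: f scaleC_add_right add.assoc)
    moreover have "(\<Gamma>\<^sub>1 f, \<Gamma>\<^sub>0 f) \<in> B"
      using linear_op_add[OF B d b(2)] a(2)
      by (simp add: f boundary_map_add[OF linear_\<Gamma>\<^sub>0 doms] boundary_map_add[OF linear_\<Gamma>\<^sub>1 doms])
    ultimately show "(g, f) \<in> ?L"
      by (simp add: in_resolvent_op_iff extension_op_def)
  qed
  then show ?thesis
    by auto
qed

end

theorem theorem2p6:
  fixes S T :: "('h::complex_hilbert \<times> 'h) set"
    and \<Gamma>\<^sub>0 \<Gamma>\<^sub>1 :: "'h \<Rightarrow> 'g::complex_hilbert"
    and B :: "('g \<times> 'g) set"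
    and z\<^sub>0 :: complex
  assumes "linear_op S" and "densely_defined S" and "closed S" and "symmetric_op S"
    and "quasi_boundary_triple S T \<Gamma>\<^sub>0 \<Gamma>\<^sub>1"
    and "linear_op B"
    and "z\<^sub>0 \<in> resolvent_set (restrict_ker T \<Gamma>\<^sub>0) \<inter> \<real>"
    and "symmetric_op B"
    and "1 \<in> resolvent_set (B \<circ>\<^sub>o closure (weyl_function T \<Gamma>\<^sub>0 \<Gamma>\<^sub>1 z\<^sub>0))"
    and "B `` (Range (closure (weyl_function T \<Gamma>\<^sub>0 \<Gamma>\<^sub>1 z\<^sub>0)) \<inter> Domain B) \<subseteq> \<Gamma>\<^sub>0 ` Domain T"
    and "\<Gamma>\<^sub>1 ` Domain T \<subseteq> Domain B"
    and "B `` (\<Gamma>\<^sub>1 ` Domain T) \<subseteq> \<Gamma>\<^sub>0 ` Domain T \<or> z\<^sub>0 \<in> resolvent_set (restrict_ker T \<Gamma>\<^sub>1)"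
  shows "self_adjoint_op (extension_op T \<Gamma>\<^sub>0 \<Gamma>\<^sub>1 B) \<and>
    S \<subseteq> extension_op T \<Gamma>\<^sub>0 \<Gamma>\<^sub>1 B \<and>
    z\<^sub>0 \<in> resolvent_set (extension_op T \<Gamma>\<^sub>0 \<Gamma>\<^sub>1 B) \<and>
    (\<forall>z \<in> resolvent_set (extension_op T \<Gamma>\<^sub>0 \<Gamma>\<^sub>1 B) \<inter> resolvent_set (restrict_ker T \<Gamma>\<^sub>0).
      resolvent_op (extension_op T \<Gamma>\<^sub>0 \<Gamma>\<^sub>1 B) z =
        resolvent_op (restrict_ker T \<Gamma>\<^sub>0) z +\<^sub>o
          gamma_field T \<Gamma>\<^sub>0 z
            \<circ>\<^sub>o converse (Id -\<^sub>o B \<circ>\<^sub>o weyl_function T \<Gamma>\<^sub>0 \<Gamma>\<^sub>1 z)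
            \<circ>\<^sub>o B \<circ>\<^sub>o adjoint_op (gamma_field T \<Gamma>\<^sub>0 (cnj z)))"
proof -
  interpret boundary_triple S T \<Gamma>\<^sub>0 \<Gamma>\<^sub>1
    using assms(5) by unfold_locales
  let ?A = "extension_op T \<Gamma>\<^sub>0 \<Gamma>\<^sub>1 B"
  have S: "S \<subseteq> ?A"
    using assms(6) by (rule minimal_operator_subset_extension)
  have dense: "densely_defined ?A"
    using assms(2) closure_mono[OF Domain_mono[OF S]] by (auto simp: densely_defined_def)
  have z\<^sub>0: "z\<^sub>0 \<in> resolvent_set A\<^sub>0" "z\<^sub>0 \<in> \<real>"
    using assms(7) by simp_all
  have surj: "\<exists>f. (f, g + z\<^sub>0 *\<^sub>C f) \<in> ?A" for g
    by (rule extension_surj[OF assms(6) z\<^sub>0 assms(9-11) boundary_operator_range[OF assms(10,12)]])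
  note extension = linear_extension[OF assms(6)] symmetric_extension[OF assms(8)] dense z\<^sub>0(2) surj
  show ?thesis
  proof (intro conjI ballI)
    show "self_adjoint_op ?A" "z\<^sub>0 \<in> resolvent_set ?A"
      by (rule symmetric_surj_imp_self_adjoint[OF extension])+
    show "S \<subseteq> ?A"
      by (rule S)
  next
    fix z
    assume "z \<in> resolvent_set ?A \<inter> resolvent_set A\<^sub>0"
    then show "resolvent_op ?A z = resolvent_op A\<^sub>0 z +\<^sub>o
        gamma_field T \<Gamma>\<^sub>0 z \<circ>\<^sub>o converse (Id -\<^sub>o B \<circ>\<^sub>o weyl_function T \<Gamma>\<^sub>0 \<Gamma>\<^sub>1 z)
          \<circ>\<^sub>o B \<circ>\<^sub>o adjoint_op (gamma_field T \<Gamma>\<^sub>0 (cnj z))"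
      by (intro Krein_formula[OF assms(6,11)]) (rule IntD2)
  qed
qed

end
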